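(* Let $S\colon V_\infty\to V_\infty$ be the isometry $S\left((x_k)_{k=0}^\infty\right)=(0,A_0x_0,A_1x_1,A_2x_2,\dots)$. Then the unitary part $U$ in the Wold-von Neumann decomposition of $S$ is zero, i.e. $\bigcap_{n=0}^\infty S^n(V_\infty)=\{0\}$.
   Context: $\mathbb{N}=\{0,1,2,\dots\}$. For any positive integer $m$ and $k\in\mathbb{N}$, $\omega_{m,k}=\exp\left(\frac{(2m-1)\pi i}{2^k}\right)$, and $\Omega_{m,k}\colon\mathbb{N}\to\mathbb{C}$ is the function $\Omega_{m,k}(n)=\omega_{m,k}^n$; both depend only on $m$ modulo $2^k$. $V_k$ is the complex vector space of functions spanned by $\Omega_{1,k},\dots,\Omega_{2^k,k}$ (which are linearly independent), with the inner product making $(\Omega_{j,k})_{j=1}^{2^k}$ an orthonormal basis. $A_k\colon V_k\to V_{k+1}$ is the (isometric) linear operator with $$A_k(\Omega_{j,k})=\tfrac12\Omega_{j,k+1}+\tfrac{\omega_{j,k+1}}{2}\Omega_{3j-1,k+1}+\tfrac12\Omega_{2^k+j,k+1}-\tfrac{\omega_{j,k+1}}{2}\Omega_{2^k+3j-1,k+1},\quad j=1,\dots,2^k.$$ $V_\infty=\bigoplus_{k=0}^\infty V_k$ is the Hilbert space direct sum. The unitary part of an isometry $S$ is its restriction to the $S$-invariant subspace $\bigcap_{n\ge0}S^n(V_\infty)$. *)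

theory Defs
  imports "HOL-Analysis.Analysis" "HOL-Library.Function_Algebras"
begin

definition cscale :: "complex \<Rightarrow> (nat \<Rightarrow> complex) \<Rightarrow> (nat \<Rightarrow> complex)"  (infixr "\<cdot>\<^sub>C" 75)
  where "c \<cdot>\<^sub>C f = (\<lambda>n. c * f n)"

interpretation cfun: vector_space cscale
  by unfold_locales (auto simp: cscale_def fun_eq_iff algebra_simps)

definition omega :: "nat \<Rightarrow> nat \<Rightarrow> complex"
  where "omega m k = exp (complex_of_real ((2 * real m - 1) * pi / 2 ^ k) * \<i>)"

definition Omega :: "nat \<Rightarrow> nat \<Rightarrow> (nat \<Rightarrow> complex)"
  where "Omega m k = (\<lambda>n. omega m k ^ n)"

definition Omega_basis :: "nat \<Rightarrow> (nat \<Rightarrow> complex) set"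
  where "Omega_basis k = (\<lambda>j. Omega j k) ` {1..2 ^ k}"

definition V :: "nat \<Rightarrow> (nat \<Rightarrow> complex) set"
  where "V k = cfun.span (Omega_basis k)"

definition coord :: "nat \<Rightarrow> (nat \<Rightarrow> complex) \<Rightarrow> nat \<Rightarrow> complex"
  where "coord k f j = cfun.representation (Omega_basis k) f (Omega j k)"

text \<open>The inner product for which the \<open>Omega j k\<close>, \<open>1 \<le> j \<le> 2 ^ k\<close>, are orthonormal
  (see \<open>inner_V_Omega\<close> below). It is linear in the first argument.\<close>

definition inner_V :: "nat \<Rightarrow> (nat \<Rightarrow> complex) \<Rightarrow> (nat \<Rightarrow> complex) \<Rightarrow> complex"
  where "inner_V k f g = (\<Sum>j = 1..2 ^ k. coord k f j * cnj (coord k g j))"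

definition norm_V :: "nat \<Rightarrow> (nat \<Rightarrow> complex) \<Rightarrow> real"
  where "norm_V k f = sqrt (Re (inner_V k f f))"

definition A_image :: "nat \<Rightarrow> nat \<Rightarrow> (nat \<Rightarrow> complex)"
  where "A_image k j =
    (1 / 2) \<cdot>\<^sub>C Omega j (k + 1)
    + (omega j (k + 1) / 2) \<cdot>\<^sub>C Omega (3 * j - 1) (k + 1)
    + (1 / 2) \<cdot>\<^sub>C Omega (2 ^ k + j) (k + 1)
    - (omega j (k + 1) / 2) \<cdot>\<^sub>C Omega (2 ^ k + 3 * j - 1) (k + 1)"

text \<open>The linear extension of \<open>Omega j k \<mapsto> A_image k j\<close>; values outside \<open>V k\<close>
  are irrelevant.\<close>

definition A :: "nat \<Rightarrow> (nat \<Rightarrow> complex) \<Rightarrow> (nat \<Rightarrow> complex)"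
  where "A k f = (\<Sum>j = 1..2 ^ k. coord k f j \<cdot>\<^sub>C A_image k j)"

text \<open>The Hilbert space direct sum of the \<open>V k\<close>, with inner product \<open>inner_V_inf\<close>.\<close>

definition V_inf :: "(nat \<Rightarrow> (nat \<Rightarrow> complex)) set"
  where "V_inf = {x. (\<forall>k. x k \<in> V k) \<and> summable (\<lambda>k. (norm_V k (x k))\<^sup>2)}"

definition inner_V_inf :: "(nat \<Rightarrow> (nat \<Rightarrow> complex)) \<Rightarrow> (nat \<Rightarrow> (nat \<Rightarrow> complex)) \<Rightarrow> complex"
  where "inner_V_inf x y = (\<Sum>k. inner_V k (x k) (y k))"

definition S :: "(nat \<Rightarrow> (nat \<Rightarrow> complex)) \<Rightarrow> (nat \<Rightarrow> (nat \<Rightarrow> complex))"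
  where "S x = (\<lambda>k. case k of 0 \<Rightarrow> 0 | Suc l \<Rightarrow> A l (x l))"

text \<open>Operators on subspaces are encoded as functions restricted to their domain, so the zero
  operator on the zero space is \<open>\<lambda>x\<in>{0}. 0\<close>.\<close>

definition wold_unitary_space :: "'a set \<Rightarrow> ('a \<Rightarrow> 'a) \<Rightarrow> 'a set"
  where "wold_unitary_space H T = (\<Inter>n. (T ^^ n) ` H)"

definition wold_unitary_part :: "'a set \<Rightarrow> ('a \<Rightarrow> 'a) \<Rightarrow> ('a \<Rightarrow> 'a)"
  where "wold_unitary_part H T = restrict T (wold_unitary_space H T)"


subsection \<open>The definitions have the intended properties\<close>

lemma omega_eq_iff: "omega m k = omega n k \<longleftrightarrow> m mod 2 ^ k = n mod 2 ^ k"
proof -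
  have "omega m k = omega n k \<longleftrightarrow> (\<exists>l::int. of_real ((2 * real m - 1) * pi / 2 ^ k) * \<i>
      = of_real ((2 * real n - 1) * pi / 2 ^ k) * \<i> + (of_int (2 * l) * pi) * \<i>)"
    unfolding omega_def by (rule exp_eq)
  also have "\<dots> \<longleftrightarrow> (\<exists>l::int. int m = int n + l * 2 ^ k)"
  proof (rule ex_cong1)
    fix l :: int
    have "complex_of_real ((2 * real m - 1) * pi / 2 ^ k) * \<i>
        = of_real ((2 * real n - 1) * pi / 2 ^ k) * \<i> + (of_int (2 * l) * pi) * \<i>
      \<longleftrightarrow> (2 * real m - 1) * pi / 2 ^ k = (2 * real n - 1) * pi / 2 ^ k + of_int (2 * l) * pi"
      by (simp only: complex_eq_iff) simp
    also have "\<dots> \<longleftrightarrow> ((2 * real m - 1) - (2 * real n - 1) - of_int (2 * l) * 2 ^ k) * pi = 0"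
      by (simp only: right_diff_distrib left_diff_distrib) (auto simp: field_simps)
    also have "\<dots> \<longleftrightarrow> real m = real n + of_int l * 2 ^ k"
      unfolding mult_eq_0_iff using pi_neq_zero by (auto simp: algebra_simps)
    also have "\<dots> \<longleftrightarrow> real_of_int (int m) = real_of_int (int n + l * 2 ^ k)"
      by simp
    also have "\<dots> \<longleftrightarrow> int m = int n + l * 2 ^ k"
      by (simp only: of_int_eq_iff)
    finally show "complex_of_real ((2 * real m - 1) * pi / 2 ^ k) * \<i>
        = of_real ((2 * real n - 1) * pi / 2 ^ k) * \<i> + (of_int (2 * l) * pi) * \<i>
      \<longleftrightarrow> int m = int n + l * 2 ^ k" .
  qed
  also have "\<dots> \<longleftrightarrow> int m mod 2 ^ k = int n mod 2 ^ k"
    by (auto simp: mod_eq_dvd_iff dvd_def algebra_simps)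
  also have "\<dots> \<longleftrightarrow> m mod 2 ^ k = n mod 2 ^ k"
  proof -
    have "int x mod 2 ^ k = int (x mod 2 ^ k)" for x :: nat
      by (simp add: zmod_int)
    then show ?thesis by simp
  qed
  finally show ?thesis .
qed

lemma Omega_eq_iff: "Omega m k = Omega n k \<longleftrightarrow> m mod 2 ^ k = n mod 2 ^ k"
proof -
  have "omega m k = omega n k" if "Omega m k = Omega n k"
    using fun_cong[OF that, of 1] by (simp add: Omega_def)
  then show ?thesis
    by (auto simp: Omega_def simp flip: omega_eq_iff)
qed

lemma mod_eq_imp_eq:
  assumes "i mod N = j mod N" "i \<in> {1..N}" "j \<in> {1..N}"
  shows "i = (j::nat)"
  using assms by (cases "i = N"; cases "j = N") auto

lemma inj_on_Omega: "inj_on (\<lambda>j. Omega j k) {1..2 ^ k}"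
  by (rule inj_onI) (auto simp: Omega_eq_iff intro: mod_eq_imp_eq)

lemma sum_Omega_basis: "(\<Sum>x\<in>Omega_basis k. h x) = (\<Sum>j = 1..2 ^ k. h (Omega j k))"
  unfolding Omega_basis_def by (simp only: sum.reindex[OF inj_on_Omega] comp_def)

lemma sum_fun_apply: "(\<Sum>x\<in>X. f x) n = (\<Sum>x\<in>X. f x n)"
  for f :: "'b \<Rightarrow> nat \<Rightarrow> complex"
  by (induction X rule: infinite_finite_induct) auto

lemma independent_Omega_basis: "cfun.independent (Omega_basis k)"
proof (rule cfun.independent_if_scalars_zero)
  show fin: "finite (Omega_basis k)"
    by (simp add: Omega_basis_def)
  fix u v
  assume sum0: "(\<Sum>x\<in>Omega_basis k. u x \<cdot>\<^sub>C x) = 0" and v: "v \<in> Omega_basis k"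
  obtain j where j: "j \<in> {1..2 ^ k}" "v = Omega j k"
    using v by (auto simp: Omega_basis_def)
  define p where "p = (\<Prod>i\<in>{1..2 ^ k} - {j}. [:- omega i k, 1:])"
  have sumn: "(\<Sum>i = 1..2 ^ k. u (Omega i k) * omega i k ^ n) = 0" for n
  proof -
    have "(\<Sum>x\<in>Omega_basis k. u x \<cdot>\<^sub>C x) n = (\<Sum>x\<in>Omega_basis k. u x * x n)"
      by (simp add: sum_fun_apply cscale_def)
    then show ?thesis
      using sum0 unfolding sum_Omega_basis by (simp add: Omega_def)
  qed
  have "0 = (\<Sum>n\<le>degree p. coeff p n * (\<Sum>i = 1..2 ^ k. u (Omega i k) * omega i k ^ n))"
    by (simp only: sumn mult_zero_right sum.neutral_const)
  also have "\<dots> = (\<Sum>i = 1..2 ^ k. u (Omega i k) * poly p (omega i k))"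
    unfolding poly_altdef sum_distrib_left
    by (subst sum.swap) (simp add: mult.left_commute)
  also have "\<dots> = (\<Sum>i\<in>{j}. u (Omega i k) * poly p (omega i k))"
    by (rule sum.mono_neutral_right) (use j in \<open>auto simp: p_def poly_prod\<close>)
  finally have "u v * poly p (omega j k) = 0"
    by (simp add: j)
  moreover have "poly p (omega j k) \<noteq> 0"
    using j by (auto simp: p_def poly_prod omega_eq_iff dest: mod_eq_imp_eq)
  ultimately show "u v = 0" by simp
qed

lemma Omega_reduce: "\<exists>i\<in>{1..2 ^ k}. Omega m k = Omega i k"
proof (cases "m mod 2 ^ k = 0")
  case True
  then show ?thesis by (intro bexI[of _ "2 ^ k"]) (auto simp: Omega_eq_iff)
next
  case False
  then show ?thesis
    by (intro bexI[of _ "m mod 2 ^ k"]) (auto simp: Omega_eq_iff intro: less_imp_le)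
qed

lemma Omega_in_basis: "Omega m k \<in> Omega_basis k"
  using Omega_reduce[of k m] by (auto simp: Omega_basis_def)

lemma Omega_in_V: "Omega m k \<in> V k"
  unfolding V_def by (rule cfun.span_base[OF Omega_in_basis])

lemma V_closed:
  shows "0 \<in> V k" "f \<in> V k \<Longrightarrow> g \<in> V k \<Longrightarrow> f + g \<in> V k"
    "f \<in> V k \<Longrightarrow> g \<in> V k \<Longrightarrow> f - g \<in> V k" "f \<in> V k \<Longrightarrow> c \<cdot>\<^sub>C f \<in> V k"
    "(\<And>i. i \<in> I \<Longrightarrow> h i \<in> V k) \<Longrightarrow> (\<Sum>i\<in>I. h i) \<in> V k"
  unfolding V_def
  by (auto intro: cfun.span_zero cfun.span_add cfun.span_diff cfun.span_scale cfun.span_sum)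

lemma coord_linear:
  shows "coord k 0 j = 0"
    "f \<in> V k \<Longrightarrow> g \<in> V k \<Longrightarrow> coord k (f + g) j = coord k f j + coord k g j"
    "f \<in> V k \<Longrightarrow> g \<in> V k \<Longrightarrow> coord k (f - g) j = coord k f j - coord k g j"
    "f \<in> V k \<Longrightarrow> coord k (c \<cdot>\<^sub>C f) j = c * coord k f j"
  unfolding V_def coord_def using independent_Omega_basis
  by (auto simp: cfun.representation_zero cfun.representation_add cfun.representation_diff
      cfun.representation_scale)

lemma coord_sum:
  "(\<And>i. i \<in> I \<Longrightarrow> h i \<in> V k) \<Longrightarrow> coord k (\<Sum>i\<in>I. h i) j = (\<Sum>i\<in>I. coord k (h i) j)"
  by (induction I rule: infinite_finite_induct) (auto simp: coord_linear V_closed)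

lemma coord_Omega: "coord k (Omega m k) j = (if m mod 2 ^ k = j mod 2 ^ k then 1 else 0)"
  unfolding coord_def
  by (simp add: cfun.representation_basis[OF independent_Omega_basis Omega_in_basis] Omega_eq_iff
      eq_commute)

lemma coord_expansion: "f \<in> V k \<Longrightarrow> (\<Sum>j = 1..2 ^ k. coord k f j \<cdot>\<^sub>C Omega j k) = f"
  using cfun.sum_representation_eq[OF independent_Omega_basis, of f k "Omega_basis k"]
  unfolding sum_Omega_basis by (simp add: V_def coord_def Omega_basis_def)

lemma inner_V_linear:
  shows "f \<in> V k \<Longrightarrow> g \<in> V k \<Longrightarrow> inner_V k (f + g) h = inner_V k f h + inner_V k g h"
    "f \<in> V k \<Longrightarrow> g \<in> V k \<Longrightarrow> inner_V k (f - g) h = inner_V k f h - inner_V k g h"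
    "f \<in> V k \<Longrightarrow> inner_V k (c \<cdot>\<^sub>C f) h = c * inner_V k f h"
    "f \<in> V k \<Longrightarrow> g \<in> V k \<Longrightarrow> inner_V k h (f + g) = inner_V k h f + inner_V k h g"
    "f \<in> V k \<Longrightarrow> g \<in> V k \<Longrightarrow> inner_V k h (f - g) = inner_V k h f - inner_V k h g"
    "f \<in> V k \<Longrightarrow> inner_V k h (c \<cdot>\<^sub>C f) = cnj c * inner_V k h f"
  unfolding inner_V_def
  by (simp_all add: coord_linear algebra_simps sum.distrib sum_subtractf sum_distrib_left)

lemma inner_V_Omega:
  "inner_V k (Omega m k) (Omega n k) = (if m mod 2 ^ k = n mod 2 ^ k then 1 else 0)"
proof -
  obtain i where i: "i \<in> {1..2 ^ k}" "Omega m k = Omega i k"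
    using Omega_reduce by blast
  have "inner_V k (Omega i k) (Omega n k) = (\<Sum>j\<in>{i}. coord k (Omega i k) j * cnj (coord k (Omega n k) j))"
    unfolding inner_V_def
    by (rule sum.mono_neutral_right) (use i in \<open>auto simp: coord_Omega dest: mod_eq_imp_eq\<close>)
  moreover have "m mod 2 ^ k = i mod 2 ^ k"
    using i(2) by (simp add: Omega_eq_iff)
  ultimately show ?thesis
    unfolding i(2) by (auto simp: coord_Omega)
qed

lemma A_image_in_V: "A_image k j \<in> V (Suc k)"
  by (auto simp: A_image_def intro!: V_closed Omega_in_V)

lemma A_Omega: "j \<in> {1..2 ^ k} \<Longrightarrow> A k (Omega j k) = A_image k j"
proof -
  assume j: "j \<in> {1..2 ^ k}"
  have "A k (Omega j k) = (\<Sum>i\<in>{j}. coord k (Omega j k) i \<cdot>\<^sub>C A_image k i)"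
    unfolding A_def
    by (rule sum.mono_neutral_right) (use j in \<open>auto simp: coord_Omega dest: mod_eq_imp_eq\<close>)
  then show ?thesis by (simp add: coord_Omega)
qed

lemma A_in_V: "A k f \<in> V (Suc k)"
  unfolding A_def by (intro V_closed A_image_in_V)

lemma A_linear:
  shows "f \<in> V k \<Longrightarrow> g \<in> V k \<Longrightarrow> A k (f + g) = A k f + A k g"
    "f \<in> V k \<Longrightarrow> A k (c \<cdot>\<^sub>C f) = c \<cdot>\<^sub>C A k f"
  unfolding A_def
  by (simp_all add: coord_linear cfun.scale_left_distrib sum.distrib cfun.scale_sum_right)

lemma norm_omega: "omega m k * cnj (omega m k) = 1"
  by (simp add: complex_norm_square[symmetric] omega_def norm_exp_i_times mult.commute
      del: of_real_mult)

lemma inner_V_A_image: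
  assumes "i \<in> {1..2 ^ k}" "j \<in> {1..2 ^ k}"
  shows "inner_V (Suc k) (A_image k i) (A_image k j) = (if i = j then 1 else 0)"
proof -
  define N :: nat where "N = 2 ^ k"
  define D :: "nat \<Rightarrow> nat \<Rightarrow> complex"
    where "D m n = (if m mod (2 * N) = n mod (2 * N) then 1 else 0)" for m n
  have shift: "D (N + m) (N + n) = D m n" for m n
    unfolding D_def by (simp add: nat_mod_eq_iff)
  have shift2: "D m (N + n) = D (N + m) n" for m n
  proof -
    have "D (N + m) (N + (N + n)) = D (N + m) n"
      unfolding D_def by (simp add: mult_2 flip: add.assoc)
    then show ?thesis by (simp add: shift)
  qed
  have shift3: "D (N + (N + m)) n = D m n" for m n
    unfolding D_def by (simp add: mult_2 flip: add.assoc)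
  have D_zero: "D m n = 0" "D (N + m) n = 0" if "m mod N \<noteq> n mod N" for m n
  proof -
    have "m mod N = n mod N" if "(m::nat) mod (2 * N) = n mod (2 * N)" for m n
      using that by (metis mod_mult_self2 mod_mod_cancel dvd_triv_right)
    from this[of m n] this[of "N + m" n] that show "D m n = 0" "D (N + m) n = 0"
      by (auto simp: D_def)
  qed
  define p where "p = (\<lambda>i. 3 * i - (1::nat))"
  have p2: "2 ^ k + 3 * i - 1 = N + p i" if "i \<in> {1..2 ^ k}" for i
    using that by (auto simp: p_def N_def)
  define w where "w = (\<lambda>i. omega i (Suc k))"
  have img: "A_image k i = (1 / 2) \<cdot>\<^sub>C Omega i (Suc k) + (w i / 2) \<cdot>\<^sub>C Omega (p i) (Suc k)
      + (1 / 2) \<cdot>\<^sub>C Omega (N + i) (Suc k) - (w i / 2) \<cdot>\<^sub>C Omega (N + p i) (Suc k)"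
    if "i \<in> {1..2 ^ k}" for i
    using p2[OF that] by (simp add: A_image_def w_def p_def N_def)
  have in_D: "inner_V (Suc k) (Omega m (Suc k)) (Omega n (Suc k)) = D m n" for m n
    by (simp add: inner_V_Omega D_def N_def)
  have "inner_V (Suc k) (A_image k i) (A_image k j)
      = (D i j + D (N + i) j) / 2
        + w i * cnj (w j) * (D (p i) (p j) - D (N + p i) (p j)) / 2"
    unfolding img[OF assms(1)] img[OF assms(2)]
    by (simp add: inner_V_linear V_closed Omega_in_V in_D shift shift2 shift3 field_simps)
  also have "\<dots> = (if i = j then 1 else 0)"
  proof (cases "i = j")
    case True
    have "D (N + m) m = 0" "D m m = 1" for m
    proof -
      have "0 < N" by (simp add: N_def)
      have "\<not> 2 * N dvd N"
        using \<open>0 < N\<close> by (auto dest: dvd_imp_le)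
      then show "D (N + m) m = 0" "D m m = 1"
        by (auto simp: D_def mod_eq_dvd_iff_nat)
    qed
    then show ?thesis
      using True norm_omega[of j "Suc k"] by (simp add: w_def)
  next
    case False
    have ij: "i mod N \<noteq> j mod N"
      using False assms mod_eq_imp_eq unfolding N_def by blast
    have "p i mod N \<noteq> p j mod N"
    proof
      assume "p i mod N = p j mod N"
      then have "(p i + 1) mod N = (p j + 1) mod N"
        by (metis mod_add_left_eq)
      then have "(3 * i) mod N = (3 * j) mod N"
        using assms by (simp add: p_def)
      then have "int (3 * i) mod int N = int (3 * j) mod int N"
        by (simp only: zmod_int[symmetric])
      then have "int N dvd 3 * (int i - int j)"
        by (simp add: mod_eq_dvd_iff algebra_simps)
      moreover have "coprime (int N) 3"
        by (simp add: N_def)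
      ultimately have "int N dvd int i - int j"
        by (simp only: coprime_dvd_mult_right_iff)
      then have "int (i mod N) = int (j mod N)"
        by (simp add: zmod_int mod_eq_dvd_iff)
      then have "i mod N = j mod N"
        by (simp only: of_nat_eq_iff)
      with ij show False ..
    qed
    with ij False show ?thesis by (simp add: D_zero)
  qed
  finally show ?thesis .
qed

lemma A_isometry:
  assumes "f \<in> V k" "g \<in> V k"
  shows "inner_V (Suc k) (A k f) (A k g) = inner_V k f g"
proof -
  let ?J = "{1..2 ^ k} :: nat set"
  have co: "coord (Suc k) (A k f) m = (\<Sum>i\<in>?J. coord k f i * coord (Suc k) (A_image k i) m)" for f m
    by (simp add: A_def coord_sum V_closed A_image_in_V coord_linear)
  have "inner_V (Suc k) (A k f) (A k g)
      = (\<Sum>m = 1..2 ^ Suc k. \<Sum>i\<in>?J. \<Sum>j\<in>?J. coord k f i * cnj (coord k g j)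
          * (coord (Suc k) (A_image k i) m * cnj (coord (Suc k) (A_image k j) m)))"
    unfolding inner_V_def co cnj_sum sum_product by (simp add: mult_ac)
  also have "\<dots> = (\<Sum>i\<in>?J. \<Sum>j\<in>?J. \<Sum>m = 1..2 ^ Suc k. coord k f i * cnj (coord k g j)
          * (coord (Suc k) (A_image k i) m * cnj (coord (Suc k) (A_image k j) m)))"
    by (subst sum.swap, rule sum.cong[OF refl], rule sum.swap)
  also have "\<dots> = (\<Sum>i\<in>?J. \<Sum>j\<in>?J. coord k f i * cnj (coord k g j)
          * inner_V (Suc k) (A_image k i) (A_image k j))"
    unfolding inner_V_def sum_distrib_left ..
  also have "\<dots> = (\<Sum>i\<in>?J. \<Sum>j\<in>?J. if i = j then coord k f i * cnj (coord k g j) else 0)"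
    by (intro sum.cong refl) (simp add: inner_V_A_image)
  also have "\<dots> = inner_V k f g"
    by (simp add: inner_V_def)
  finally show ?thesis .
qed

lemma S_in_V_inf:
  assumes "x \<in> V_inf"
  shows "S x \<in> V_inf"
proof -
  have V: "x k \<in> V k" for k
    using assms by (simp add: V_inf_def)
  have "summable (\<lambda>k. (norm_V (Suc k) (S x (Suc k)))\<^sup>2)"
    using assms by (simp add: V_inf_def S_def norm_V_def A_isometry[OF V V])
  then have "summable (\<lambda>k. (norm_V k (S x k))\<^sup>2)"
    by (rule summable_Suc_iff[THEN iffD1])
  then show ?thesis
    by (auto simp: V_inf_def S_def V_closed A_in_V split: nat.split)
qed

lemma summable_inner_V:
  assumes "x \<in> V_inf" "y \<in> V_inf"
  shows "summable (\<lambda>k. inner_V k (x k) (y k))"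
proof (rule summable_comparison_test')
  show "summable (\<lambda>k. (norm_V k (x k))\<^sup>2 + (norm_V k (y k))\<^sup>2)"
    using assms by (intro summable_add) (auto simp: V_inf_def)
  fix k :: nat
  have sq: "(norm_V k f)\<^sup>2 = (\<Sum>j = 1..2 ^ k. (cmod (coord k f j))\<^sup>2)" for f
  proof -
    have "Re (inner_V k f f) = (\<Sum>j = 1..2 ^ k. (cmod (coord k f j))\<^sup>2)"
      by (simp add: inner_V_def complex_norm_square[symmetric] del: of_real_power)
    then show ?thesis by (simp add: norm_V_def sum_nonneg)
  qed
  have "norm (inner_V k (x k) (y k))
      \<le> (\<Sum>j = 1..2 ^ k. cmod (coord k (x k) j) * cmod (coord k (y k) j))"
    unfolding inner_V_def by (rule order_trans[OF norm_sum]) (simp add: norm_mult)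
  also have "\<dots> \<le> (\<Sum>j = 1..2 ^ k. (cmod (coord k (x k) j))\<^sup>2 + (cmod (coord k (y k) j))\<^sup>2)"
  proof (rule sum_mono)
    fix j
    show "cmod (coord k (x k) j) * cmod (coord k (y k) j)
        \<le> (cmod (coord k (x k) j))\<^sup>2 + (cmod (coord k (y k) j))\<^sup>2"
      using sum_squares_bound[of "cmod (coord k (x k) j)" "cmod (coord k (y k) j)"]
        mult_nonneg_nonneg[of "cmod (coord k (x k) j)" "cmod (coord k (y k) j)"]
      by (simp del: mult_nonneg_nonneg)
  qed
  finally show "norm (inner_V k (x k) (y k)) \<le> (norm_V k (x k))\<^sup>2 + (norm_V k (y k))\<^sup>2"
    by (simp add: sq sum.distrib)
qed

lemma S_isometry:
  assumes "x \<in> V_inf" "y \<in> V_inf"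
  shows "inner_V_inf (S x) (S y) = inner_V_inf x y"
proof -
  have V: "x k \<in> V k" "y k \<in> V k" for k
    using assms by (simp_all add: V_inf_def)
  have "inner_V_inf (S x) (S y) = (\<Sum>k. inner_V (Suc k) (S x (Suc k)) (S y (Suc k)))
      + inner_V 0 (S x 0) (S y 0)"
    unfolding inner_V_inf_def
    using suminf_split_head[OF summable_inner_V[OF assms[THEN S_in_V_inf]]] by simp
  also have "\<dots> = inner_V_inf x y"
    using V by (simp add: S_def A_isometry inner_V_inf_def inner_V_def[of 0] coord_linear)
  finally show ?thesis .
qed

end

theory Submission
  imports Defs
begin

text \<open>The operator \<open>S\<close> raises degree by one, so everything in the range of \<open>S ^^ n\<close> vanishes in
  the degrees below \<open>n\<close> (\<open>S_funpow_vanishes_below\<close>). An element of every range therefore vanishes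
  in every degree. Conversely \<open>0\<close> is a fixed point of \<open>S\<close> and so lies in every range. The unitary part
  is then \<open>S\<close> restricted to \<open>{0}\<close>, where it takes the value \<open>0\<close>.\<close>

lemma A_zero: "A k 0 = 0"
  unfolding A_def by (simp only: coord_linear cfun.scale_zero_left sum.neutral_const)

lemma S_degree:
  shows S_degree_0: "S x 0 = 0"
    and S_degree_Suc: "S x (Suc l) = A l (x l)"
  by (simp_all add: S_def)

lemma S_funpow_vanishes_below: "k < n \<Longrightarrow> (S ^^ n) x k = 0"
proof (induction n arbitrary: k)
  case 0
  then show ?case by simp
next
  case (Suc n)
  show ?case
  proof (cases k)
    case 0
    show ?thesis
      unfolding 0 funpow.simps comp_apply by (rule S_degree_0)
  next
    case k: (Suc l)
    have "(S ^^ n) x l = 0"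
      using Suc.prems by (intro Suc.IH) (simp add: k)
    then show ?thesis
      by (simp only: k funpow.simps comp_apply S_degree_Suc A_zero)
  qed
qed

lemma S_zero: "S 0 = 0"
proof
  fix k
  show "S 0 k = 0 k"
    using A_zero by (cases k) (simp_all add: S_def)
qed

lemma S_funpow_zero: "(S ^^ n) 0 = 0"
  by (induction n) (simp_all only: funpow.simps id_apply comp_apply S_zero)

lemma zero_in_V_inf: "0 \<in> V_inf"
  by (simp add: V_inf_def V_closed norm_V_def inner_V_def coord_linear)

lemma Inter_range_S_funpow: "(\<Inter>n. (S ^^ n) ` V_inf) = {0}"
proof
  show "(\<Inter>n. (S ^^ n) ` V_inf) \<subseteq> {0}"
  proof
    fix y assume y: "y \<in> (\<Inter>n. (S ^^ n) ` V_inf)"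
    have "y k = 0" for k
    proof -
      \<comment> \<open>Degree \<open>k\<close> is killed by \<open>k + 1\<close> applications of \<open>S\<close>, not yet by \<open>k\<close> of them.\<close>
      from y obtain x where "y = (S ^^ Suc k) x"
        by blast
      then show ?thesis
        using S_funpow_vanishes_below[of k "Suc k"] by simp
    qed
    then show "y \<in> {0}"
      by (simp add: fun_eq_iff)
  qed
  have "0 \<in> (S ^^ n) ` V_inf" for n
    using imageI[OF zero_in_V_inf, of "S ^^ n"] by (simp add: S_funpow_zero)
  then show "{0} \<subseteq> (\<Inter>n. (S ^^ n) ` V_inf)"
    by blast
qed

theorem proposition9p1:
  shows "wold_unitary_part V_inf S = (\<lambda>x\<in>{0}. 0) \<and> (\<Inter>n. (S ^^ n) ` V_inf) = {0}"
proof
  show "wold_unitary_part V_inf S = (\<lambda>x\<in>{0}. 0)"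
    unfolding wold_unitary_part_def wold_unitary_space_def Inter_range_S_funpow
    by (rule restrict_ext) (simp add: S_zero)
qed (rule Inter_range_S_funpow)

end
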